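(* Let $n\ge6$ be even and let $Q_n$ be the complex Lie algebra with basis $(e_1,\ldots,e_n)$ and Lie brackets $[e_1,e_i]=e_{i+1}$ for $2\le i\le n-1$ and $[e_i,e_{n-i+1}]=(-1)^{i+1}e_n$ for $2\le i\le\frac n2$ (all other brackets of basis vectors not obtained by skew-symmetry being zero). Every CPA-structure on $Q_n$ is given by $$e_1\cdot e_1=\alpha e_{n-1}+\beta e_n,\quad e_1\cdot e_2=-\alpha e_{n-1}+\gamma e_n,\quad e_2\cdot e_2=\alpha e_{n-1}+\delta e_n,$$ with arbitrary parameters $\alpha,\beta,\gamma,\delta\in\mathbb{C}$ (and all choices of these parameters give CPA-structures).
   Context: A commutative post-Lie algebra structure (CPA-structure) on a Lie algebra $\mathfrak{g}=(V,[\,,])$ is a bilinear product $x\cdot y$ on $V$ such that for all $x,y,z\in V$: $x\cdot y=y\cdot x$; $[x,y]\cdot z=x\cdot(y\cdot z)-y\cdot(x\cdot z)$; $x\cdot[y,z]=[x\cdot y,z]+[y,x\cdot z]$. Products are listed only for $e_i\cdot e_j$ with $i\le j$; all products $e_i\cdot e_j$, $i\le j$, not listed are zero, and those with $i>j$ are determined by commutativity. *)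

theory Defs
  imports Complex_Main
begin

definition bilinear_op :: "('k::field \<Rightarrow> 'v::ab_group_add \<Rightarrow> 'v) \<Rightarrow> ('v \<Rightarrow> 'v \<Rightarrow> 'v) \<Rightarrow> bool" where
  "bilinear_op scale f \<longleftrightarrow>
     (\<forall>y. Vector_Spaces.linear scale scale (\<lambda>x. f x y)) \<and>
     (\<forall>x. Vector_Spaces.linear scale scale (\<lambda>y. f x y))"

locale lie_algebra = vector_space scale
  for scale :: "'k::field \<Rightarrow> 'v::ab_group_add \<Rightarrow> 'v" +
  fixes br :: "'v \<Rightarrow> 'v \<Rightarrow> 'v"
  assumes br_bilinear: "bilinear_op scale br"
    and br_alternating: "br x x = 0"
    and jacobi: "br x (br y z) + br y (br z x) + br z (br x y) = 0"

locale cpa_structure = lie_algebra scale br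
  for scale :: "'k::field \<Rightarrow> 'v::ab_group_add \<Rightarrow> 'v"
    and br :: "'v \<Rightarrow> 'v \<Rightarrow> 'v" +
  fixes prd :: "'v \<Rightarrow> 'v \<Rightarrow> 'v"
  assumes prd_bilinear: "bilinear_op scale prd"
    and prd_commute: "prd x y = prd y x"
    and prd_bracket_left: "prd (br x y) z = prd x (prd y z) - prd y (prd x z)"
    and prd_bracket_right: "prd x (br y z) = br (prd x y) z + br y (prd x z)"

text \<open>The values of \<open>e\<close> outside \<open>{1..n}\<close> play no role. The brackets of basis vectors
  that are not mentioned are determined by skew-symmetry.\<close>

locale lie_algebra_Q = lie_algebra scale br
  for scale :: "complex \<Rightarrow> 'v::ab_group_add \<Rightarrow> 'v"
    and br :: "'v \<Rightarrow> 'v \<Rightarrow> 'v" +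
  fixes n :: nat
    and e :: "nat \<Rightarrow> 'v"
  assumes e_inj: "inj_on e {1..n}"
    and e_independent: "independent (e ` {1..n})"
    and e_span: "span (e ` {1..n}) = UNIV"
    and br_e1: "\<And>i. 2 \<le> i \<Longrightarrow> i \<le> n - 1 \<Longrightarrow> br (e 1) (e i) = e (i + 1)"
    and br_dual: "\<And>i. 2 \<le> i \<Longrightarrow> i \<le> n div 2 \<Longrightarrow>
          br (e i) (e (n - i + 1)) = scale ((-1) ^ (i + 1)) (e n)"
    and br_other: "\<And>i j. 1 \<le> i \<Longrightarrow> i < j \<Longrightarrow> j \<le> n \<Longrightarrow>
          \<not> (i = 1 \<and> 2 \<le> j \<and> j \<le> n - 1) \<Longrightarrow>
          \<not> (2 \<le> i \<and> i \<le> n div 2 \<and> j = n - i + 1) \<Longrightarrow> br (e i) (e j) = 0"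

definition Q_product ::
  "(complex \<Rightarrow> 'v::ab_group_add \<Rightarrow> 'v) \<Rightarrow> nat \<Rightarrow> (nat \<Rightarrow> 'v) \<Rightarrow>
   complex \<Rightarrow> complex \<Rightarrow> complex \<Rightarrow> complex \<Rightarrow> ('v \<Rightarrow> 'v \<Rightarrow> 'v) \<Rightarrow> bool" where
  "Q_product scale n e \<alpha> \<beta> \<gamma> \<delta> prd \<longleftrightarrow>
     bilinear_op scale prd \<and> (\<forall>x y. prd x y = prd y x) \<and>
     prd (e 1) (e 1) = scale \<alpha> (e (n - 1)) + scale \<beta> (e n) \<and>
     prd (e 1) (e 2) = - scale \<alpha> (e (n - 1)) + scale \<gamma> (e n) \<and>
     prd (e 2) (e 2) = scale \<alpha> (e (n - 1)) + scale \<delta> (e n) \<and>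
     (\<forall>i j. 1 \<le> i \<and> i \<le> j \<and> j \<le> n \<and> (i, j) \<notin> {(1, 1), (1, 2), (2, 2)} \<longrightarrow>
        prd (e i) (e j) = 0)"

end

theory Submission
  imports Defs
begin

text \<open>
  Put \<open>f 1 = e 1 + e 2\<close> and \<open>f i = e i\<close> for \<open>i \<ge> 2\<close>. In this basis every derivation is almost a
  Toeplitz matrix, determined by its values on the generators \<open>f 1\<close> and \<open>f 2\<close>. All left
  multiplications of a CPA-structure are derivations, so the three products \<open>f 1 \<cdot> f 1\<close>,
  \<open>f 1 \<cdot> f 2\<close>, \<open>f 2 \<cdot> f 2\<close> determine the structure constants. Comparing \<open>f 3 \<cdot> f k\<close> with
  \<open>f k \<cdot> f 3\<close> for \<open>k = n + 1 - i\<close> kills the \<open>f i\<close>-coordinate of \<open>f 1 \<cdot> f 2\<close> for odd \<open>i\<close>: the bracket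
  is skew, while the product is symmetric. The remaining coordinates die by reading
  \<open>[f 1, f b] \<cdot> c = f 1 \<cdot> (f b \<cdot> c) - f b \<cdot> (f 1 \<cdot> c)\<close> coordinatewise. Conversely, with
  \<open>\<lambda> = c\<^sub>1 - c\<^sub>2\<close> in the coordinates \<open>c\<^sub>i\<close> of the basis \<open>e\<close>, the \<open>e (n - 1)\<close>-part of the listed product is
  \<open>\<alpha> \<lambda>(x) \<lambda>(y)\<close>, and \<open>[e (n - 1), z] = - \<lambda>(z) e n\<close>; hence \<open>[x \<cdot> y, z]\<close> is totally symmetric.
\<close>

declare One_nat_def [simp del]

lemma small_nat_cases:
  obtains "k = (0::nat)" | "k = 1" | "k = 2" | "k = 3" | "4 \<le> k"
  by linarith

lemma sum_single:
  fixes g :: "'a \<Rightarrow> 'b::comm_monoid_add"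
  assumes "finite A" "k \<in> A" "\<And>i. i \<in> A \<Longrightarrow> i \<noteq> k \<Longrightarrow> g i = 0"
  shows "sum g A = g k"
proof -
  have "sum g A = sum g {k}"
    using assms by (intro sum.mono_neutral_right) auto
  then show ?thesis by simp
qed

subsection \<open>Coordinates and brackets\<close>

locale lie_algebra_Q_even = lie_algebra_Q scale br n e
  for scale :: "complex \<Rightarrow> 'v::ab_group_add \<Rightarrow> 'v"
    and br :: "'v \<Rightarrow> 'v \<Rightarrow> 'v" and n :: nat and e :: "nat \<Rightarrow> 'v" +
  assumes n_ge: "n \<ge> 6" and n_even: "even n"
begin

definition f :: "nat \<Rightarrow> 'v" where
  "f = e(1 := e 1 + e 2)"

definition coef :: "nat \<Rightarrow> 'v \<Rightarrow> complex" where
  "coef i v = representation (e ` {1..n}) v (e i)"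

text \<open>Coordinates in the basis \<open>f\<close>: since \<open>e 1 = f 1 - f 2\<close>, only
  the second one differs from its counterpart in the basis \<open>e\<close>.\<close>

definition kap :: "nat \<Rightarrow> 'v \<Rightarrow> complex" where
  "kap i v = (if i = 2 then coef 2 v - coef 1 v else coef i v)"

lemma n_simps [simp]:
  "\<not> n \<le> n - 1" "n - 1 \<noteq> n" "n \<noteq> n - 1" "n - 1 < n" "Suc (n - 1) = n" "n + 1 - (n - 1) = 2" "n + 1 - 2 = n - 1" "Suc n - 2 = n - 1"
  "n - 1 \<noteq> 1" "n - 1 \<noteq> 2"
  using n_ge by auto

lemma f_simps: "f 1 = e 1 + e 2" "i \<noteq> 1 \<Longrightarrow> f i = e i"
  by (simp_all add: f_def)

lemma br_left: "Vector_Spaces.linear scale scale (\<lambda>x. br x y)"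
  and br_right: "Vector_Spaces.linear scale scale (\<lambda>y. br x y)"
  using br_bilinear by (auto simp: bilinear_op_def)

lemma br_add_left: "br (x + x') y = br x y + br x' y"
  using br_left[of y] by (simp add: Vector_Spaces.linear_iff)

lemma br_add_right: "br y (x + x') = br y x + br y x'"
  using br_right[of y] by (simp add: Vector_Spaces.linear_iff)

lemma br_skew: "br x y = - br y x"
proof -
  have "br x y + br y x = br (x + y) (x + y)"
    unfolding br_add_left br_add_right by (simp add: br_alternating)
  also have "\<dots> = 0" by (rule br_alternating)
  finally have "br x y + br y x = 0" .
  then show ?thesis by (simp add: eq_neg_iff_add_eq_0)
qed

lemma coef_add: "coef i (x + y) = coef i x + coef i y"
  and coef_scale: "coef i (scale c x) = c * coef i x"
  and coef_minus: "coef i (- x) = - coef i x"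
  and coef_zero: "coef i 0 = 0"
  using e_independent e_span
  by (simp_all add: coef_def representation_add representation_scale representation_neg
      representation_zero)

lemma coef_e: "i \<in> {1..n} \<Longrightarrow> j \<in> {1..n} \<Longrightarrow> coef i (e j) = (if i = j then 1 else 0)"
  using e_independent inj_on_eq_iff[OF e_inj]
  by (auto simp: coef_def representation_basis)

lemma sum_coef: "(\<Sum>i=1..n. scale (coef i v) (e i)) = v"
proof -
  have "(\<Sum>b\<in>e ` {1..n}. scale (representation (e ` {1..n}) v b) b) = v"
    using e_independent e_span by (intro sum_representation_eq) auto
  then show ?thesis using e_inj by (simp add: sum.reindex coef_def)
qed

lemma kap_add: "kap i (x + y) = kap i x + kap i y"
  and kap_scale: "kap i (scale c x) = c * kap i x"
  and kap_minus: "kap i (- x) = - kap i x"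
  and kap_zero: "kap i 0 = 0"
  by (auto simp: kap_def coef_add coef_scale coef_minus coef_zero algebra_simps)

lemma kap_diff: "kap i (x - y) = kap i x - kap i y"
  using kap_add[of i x "- y"] by (simp add: kap_minus)

lemma kap_sum: "kap i (sum g A) = (\<Sum>a\<in>A. kap i (g a))"
  by (induction A rule: infinite_finite_induct) (auto simp: kap_zero kap_add)

lemma kap_f: "i \<in> {1..n} \<Longrightarrow> j \<in> {1..n} \<Longrightarrow> kap i (f j) = (if i = j then 1 else 0)"
  using n_ge by (auto simp: kap_def f_def coef_add coef_e)

lemma sum_kap: "(\<Sum>i=1..n. scale (kap i v) (f i)) = v"
proof -
  have split: "{1..n} = insert 1 (insert 2 {3..n})" using n_ge by auto
  have "(\<Sum>i=1..n. scale (kap i v) (f i)) = (\<Sum>i=1..n. scale (coef i v) (e i))"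
    unfolding split by (simp add: kap_def f_def algebra_simps scale_right_distrib scale_left_diff_distrib)
  then show ?thesis by (simp only: sum_coef)
qed

lemma kap_eqI:
  assumes "\<And>i. 1 \<le> i \<Longrightarrow> i \<le> n \<Longrightarrow> kap i x = kap i y"
  shows "x = y"
proof -
  have "(\<Sum>i=1..n. scale (kap i x) (f i)) = (\<Sum>i=1..n. scale (kap i y) (f i))"
    by (rule sum.cong) (auto simp: assms)
  then show ?thesis by (simp only: sum_kap)
qed

lemma linear_expand_e:
  assumes "Vector_Spaces.linear scale scale g"
  shows "g v = (\<Sum>i=1..n. scale (coef i v) (g (e i)))"
proof -
  interpret Vector_Spaces.linear scale scale g by (rule assms)
  have "g v = g (\<Sum>i=1..n. scale (coef i v) (e i))" by (simp only: sum_coef)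
  then show ?thesis by (simp add: sum scale)
qed

lemma linear_expand:
  assumes "Vector_Spaces.linear scale scale g"
  shows "g v = (\<Sum>i=1..n. scale (kap i v) (g (f i)))"
proof -
  interpret Vector_Spaces.linear scale scale g by (rule assms)
  have "g v = g (\<Sum>i=1..n. scale (kap i v) (f i))" by (simp only: sum_kap)
  then show ?thesis by (simp add: sum scale)
qed

lemma kap_linear_expand:
  assumes "Vector_Spaces.linear scale scale g"
  shows "kap m (g v) = (\<Sum>i=1..n. kap i v * kap m (g (f i)))"
  by (subst linear_expand[OF assms]) (simp add: kap_sum kap_scale)

text \<open>As \<open>n + 1\<close> is odd, indices with \<open>i + j = n + 1\<close> have opposite
  parity. The listed signs are therefore already skew, and one formula covers both orders without a
  diagonal term.\<close>

lemma br_e: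
  assumes "2 \<le> i" "i \<le> n" "2 \<le> j" "j \<le> n"
  shows "br (e i) (e j) = (if i + j = n + 1 then scale ((-1) ^ (i + 1)) (e n) else 0)"
proof -
  have lt: "br (e i) (e j) = (if i + j = n + 1 then scale ((-1) ^ (i + 1)) (e n) else 0)"
    if "2 \<le> i" "i < j" "j \<le> n" for i j
  proof (cases "i + j = n + 1")
    case True
    then have "i \<le> n div 2" "j = n - i + 1" using that by auto
    then show ?thesis using True br_dual[of i] that by simp
  next
    case False
    then have "j \<noteq> n - i + 1" using that by linarith
    then show ?thesis using br_other[of i j] False that by simp
  qed
  consider "i < j" | "i = j" | "j < i" by linarith
  then show ?thesis
  proof cases
    case 1 then show ?thesis using lt assms by blast
  next
    case 2
    have "i + i \<noteq> n + 1" using n_even by presburger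
    then show ?thesis using 2 by (simp add: br_alternating)
  next
    case 3
    have "(-1 :: complex) ^ (i + 1) = - ((-1) ^ (j + 1))" if "i + j = n + 1"
    proof -
      have "even i = odd j" using that n_even by presburger
      then show ?thesis by (cases "even i") auto
    qed
    then show ?thesis using lt[of j i] 3 assms br_skew[of "e i" "e j"] by (auto simp: add.commute)
  qed
qed

lemma br_f:
  assumes "2 \<le> i" "i \<le> n" "2 \<le> j" "j \<le> n"
  shows "br (f i) (f j) = (if i + j = n + 1 then scale (- ((-1) ^ i)) (f n) else 0)"
  using br_e[OF assms] assms n_ge by (simp add: f_simps power_add)

text \<open>In the basis \<open>f\<close> the brackets are graded by a torus of rank two; in particular
  \<open>e 1 + e 2\<close> commutes with \<open>e (n - 1)\<close>.\<close>

lemma br_f1: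
  assumes "2 \<le> j" "j \<le> n"
  shows "br (f 1) (f j) = (if j \<le> n - 2 then f (Suc j) else 0)"
proof -
  have "br (e 1) (e n) = 0" using br_other[of 1 n] n_ge by auto
  moreover have "br (e 2) (e j) = (if j = n - 1 then - e n else 0)"
    using br_e[of 2 j] assms n_ge by auto
  ultimately show ?thesis
    using br_e1[of j] assms n_ge by (cases "j = n"; cases "j = n - 1") (auto simp: f_simps br_add_left Suc_eq_plus1)
qed

lemma kap_br_f1:
  assumes "1 \<le> m" "m \<le> n"
  shows "kap m (br (f 1) y) = (if 3 \<le> m \<and> m \<le> n - 1 then kap (m - 1) y else 0)"
proof -
  have "kap m (br (f 1) y) = (\<Sum>j=1..n. kap j y * kap m (br (f 1) (f j)))"
    by (rule kap_linear_expand[OF br_right])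
  also have "\<dots> = (\<Sum>j=1..n. if j = m - 1 then (if 3 \<le> m \<and> m \<le> n - 1 then kap j y else 0) else 0)"
  proof (rule sum.cong[OF refl])
    fix j assume "j \<in> {1..n}"
    then show "kap j y * kap m (br (f 1) (f j)) =
        (if j = m - 1 then (if 3 \<le> m \<and> m \<le> n - 1 then kap j y else 0) else 0)"
      using assms n_ge
      by (cases "j = 1") (auto simp: br_alternating br_f1 kap_f kap_zero)
  qed
  also have "\<dots> = (if 3 \<le> m \<and> m \<le> n - 1 then kap (m - 1) y else 0)"
    using assms n_ge by (subst sum.delta) auto
  finally show ?thesis .
qed

text \<open>The first summand is the bracket with \<open>f 1\<close>, the second the pairing of
  \<open>f i\<close> with \<open>f (n + 1 - i)\<close>. For \<open>i = n\<close> the partner index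
  would be 1, outside the pairing; hence the guard \<open>i \<noteq> n\<close>.\<close>

lemma kap_br_f:
  assumes "2 \<le> i" "i \<le> n" "1 \<le> m" "m \<le> n"
  shows "kap m (br (f i) y) = (if m = Suc i \<and> m \<le> n - 1 then - kap 1 y else 0)
     + (if m = n \<and> i \<noteq> n then - ((-1) ^ i) * kap (n + 1 - i) y else 0)"
proof -
  have "kap m (br (f i) y) = (\<Sum>j=1..n. kap j y * kap m (br (f i) (f j)))"
    by (rule kap_linear_expand[OF br_right])
  also have "\<dots> = (\<Sum>j=1..n. (if j = 1 then (if m = Suc i \<and> m \<le> n - 1 then - kap j y else 0) else 0)
     + (if j = n + 1 - i then (if m = n \<and> i \<noteq> n then - ((-1) ^ i) * kap j y else 0) else 0))"
  proof (rule sum.cong[OF refl])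
    fix j assume j: "j \<in> {1..n}"
    show "kap j y * kap m (br (f i) (f j)) =
       (if j = 1 then (if m = Suc i \<and> m \<le> n - 1 then - kap j y else 0) else 0)
     + (if j = n + 1 - i then (if m = n \<and> i \<noteq> n then - ((-1) ^ i) * kap j y else 0) else 0)"
    proof (cases "j = 1")
      case True
      then show ?thesis using assms n_ge
        by (auto simp: br_skew[of "f i" "f 1"] br_f1 kap_f kap_zero kap_minus)
    next
      case False
      then show ?thesis using assms n_ge j
        by (auto simp: br_f kap_f kap_zero kap_scale kap_minus)
    qed
  qed
  also have "\<dots> = (if m = Suc i \<and> m \<le> n - 1 then - kap 1 y else 0)
     + (if m = n \<and> i \<noteq> n then - ((-1) ^ i) * kap (n + 1 - i) y else 0)"
    using assms n_ge by (subst sum.distrib, subst sum.delta, simp, subst sum.delta) auto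
  finally show ?thesis .
qed

subsection \<open>Derivations\<close>

text \<open>Modulo \<open>f n\<close>, a derivation acts on the abelian ideal spanned by \<open>f 2, \<dots>, f n\<close> as a
  polynomial in the shift \<open>br (f 1)\<close>, up to a grading derivation; its matrix is therefore
  essentially a Toeplitz matrix.\<close>

context
  fixes D :: "'v \<Rightarrow> 'v"
  assumes D_linear: "Vector_Spaces.linear scale scale D"
    and D_br: "\<And>x y. D (br x y) = br (D x) y + br x (D y)"
begin

lemma der_0: "D 0 = 0" and der_minus: "D (- x) = - D x"
proof -
  interpret Vector_Spaces.linear scale scale D by (rule D_linear)
  show "D 0 = 0" by (rule zero)
  show "D (- x) = - D x" by (rule neg)
qed

text \<open>Applying \<open>D\<close> to \<open>f (Suc k) = [f 1, f k]\<close> gives a recursion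
  along the diagonals of its matrix. The shift never reaches \<open>f n\<close>, whose coordinate
  comes only from the pairing of \<open>f k\<close> with \<open>D (f 1)\<close>.\<close>

lemma der_Suc:
  assumes "2 \<le> k" "k \<le> n - 2" "1 \<le> m" "m \<le> n"
  shows "kap m (D (f (Suc k))) =
    (if m = Suc k then kap 1 (D (f 1)) else 0)
    + (if m = n then (-1) ^ k * kap (n + 1 - k) (D (f 1)) else 0)
    + (if 3 \<le> m \<and> m \<le> n - 1 then kap (m - 1) (D (f k)) else 0)"
proof -
  have "f (Suc k) = br (f 1) (f k)" using assms n_ge br_f1[of k] by simp
  then have "D (f (Suc k)) = br (f 1) (D (f k)) - br (f k) (D (f 1))"
    using D_br[of "f 1" "f k"] br_skew[of "D (f 1)" "f k"] by simp
  then show ?thesis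
    using assms n_ge kap_br_f1[of m "D (f k)"] kap_br_f[of k m "D (f 1)"]
    by (auto simp: kap_diff)
qed

text \<open>\<open>f 2\<close> and \<open>f 3\<close> commute because \<open>n \<ge> 6\<close>. In
  the fourth coordinate of the differentiated relation only the \<open>f 1\<close> coordinate of
  \<open>D (f 2)\<close> is left.\<close>

lemma kap1_der_f2: "kap 1 (D (f 2)) = 0"
proof -
  have "br (f 2) (f 3) = 0" using br_f[of 2 3] n_ge by simp
  then have "br (f 2) (D (f 3)) - br (f 3) (D (f 2)) = 0"
    using D_br[of "f 2" "f 3"] br_skew[of "D (f 2)" "f 3"] der_0 by simp
  then have "kap 4 (br (f 2) (D (f 3))) - kap 4 (br (f 3) (D (f 2))) = 0"
    using kap_diff kap_zero by metis
  moreover have "4 \<le> n - 1" "4 \<noteq> n" using n_ge by auto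
  ultimately show ?thesis by (simp add: kap_br_f)
qed

lemma der_below:
  assumes "2 \<le> k" "k \<le> n - 1" "1 \<le> m" "m < k"
  shows "kap m (D (f k)) = 0"
  using assms
proof (induction k arbitrary: m rule: dec_induct)
  case base
  then have "m = 1" by simp
  then show ?case using kap1_der_f2 by simp
next
  case (step k)
  then show ?case using der_Suc[of k m] step.IH[of "m - 1"] by auto
qed

lemma der_diag:
  assumes "2 \<le> k" "k \<le> n - 1"
  shows "kap k (D (f k)) = kap 2 (D (f 2)) + of_nat (k - 2) * kap 1 (D (f 1))"
  using assms
proof (induction k rule: dec_induct)
  case base
  then show ?case by simp
next
  case (step k)
  then have "Suc k - 2 = Suc (k - 2)" by simp
  then show ?case using step der_Suc[of k "Suc k"] by (auto simp: algebra_simps)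
qed

lemma der_above:
  assumes "2 \<le> k" "k < m" "m \<le> n - 1"
  shows "kap m (D (f k)) = kap (m + 2 - k) (D (f 2))"
  using assms
proof (induction k arbitrary: m rule: dec_induct)
  case base
  then show ?case by simp
next
  case (step k)
  then show ?case using der_Suc[of k m] step.IH[of "m - 1"] by auto
qed

lemma der_n:
  assumes "3 \<le> k" "k \<le> n - 1"
  shows "kap n (D (f k)) = - ((-1) ^ k) * kap (n + 2 - k) (D (f 1))"
proof -
  obtain l where l: "k = Suc l" using assms by (cases k) auto
  moreover have "2 \<le> l" "l \<le> n - 2" "\<not> n \<le> n - 1" "n \<noteq> Suc l" "n + 2 - Suc l = n + 1 - l"
    using assms l n_ge by auto
  ultimately show ?thesis using n_ge der_Suc[of l n] by simp
qed

text \<open>\<open>f 1\<close> commutes with \<open>f (n - 1)\<close>, which \<open>e 1\<close> does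
  not. The last coordinate of the differentiated relation is the pairing of \<open>f (n - 1)\<close>
  with the \<open>f 2\<close> coordinate of \<open>D (f 1)\<close>.\<close>

lemma kap2_der_f1: "kap 2 (D (f 1)) = 0"
proof -
  have "br (f 1) (f (n - 1)) = 0" using br_f1[of "n - 1"] n_ge by auto
  then have "br (f 1) (D (f (n - 1))) - br (f (n - 1)) (D (f 1)) = 0"
    using D_br[of "f 1" "f (n - 1)"] br_skew[of "D (f 1)" "f (n - 1)"] der_0 by simp
  then have "kap n (br (f 1) (D (f (n - 1)))) - kap n (br (f (n - 1)) (D (f 1))) = 0"
    using kap_diff kap_zero by metis
  moreover have "n + 1 - (n - 1) = 2" using n_ge by simp
  ultimately show ?thesis using n_ge by (simp add: kap_br_f kap_br_f1)
qed

text \<open>For odd \<open>k = n + 1 - j\<close> the vectors \<open>f 2\<close> and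
  \<open>f k\<close> commute. By the Toeplitz form both terms of the differentiated relation
  contribute the same multiple of the \<open>f j\<close> coordinate, so it is zero; for odd
  \<open>j\<close> they would cancel.\<close>

lemma der_even_zero:
  assumes "even j" "4 \<le> j" "j \<le> n - 2"
  shows "kap j (D (f 2)) = 0"
proof -
  define k where "k = n + 1 - j"
  have k: "odd k" "3 \<le> k" "k \<le> n - 3" "k \<noteq> n" "n + 1 - k = j" "Suc n - k = j" "n - 1 + 2 - k = j" "Suc (n - k) = j"
    using assms n_ge n_even unfolding k_def by auto
  have "br (f 2) (f k) = 0" using br_f[of 2 k] k n_ge by auto
  then have "br (f 2) (D (f k)) - br (f k) (D (f 2)) = 0"
    using D_br[of "f 2" "f k"] br_skew[of "D (f 2)" "f k"] der_0 by simp
  then have "kap n (br (f 2) (D (f k))) - kap n (br (f k) (D (f 2))) = 0"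
    using kap_diff kap_zero by metis
  moreover have "kap n (br (f 2) (D (f k))) = - kap j (D (f 2))"
    using der_above[of k "n - 1"] k n_ge by (simp add: kap_br_f del: add_2_eq_Suc')
  moreover have "kap n (br (f k) (D (f 2))) = kap j (D (f 2))"
    using k n_ge by (simp add: kap_br_f)
  ultimately show ?thesis by simp
qed

text \<open>Since \<open>f n = [f (n - 1), f 2]\<close>, its eigenvalue is the sum of the diagonal
  entries at \<open>n - 1\<close> and 2.\<close>

lemma der_fn:
  assumes "1 \<le> m" "m \<le> n"
  shows "kap m (D (f n)) =
    (if m = n then 2 * kap 2 (D (f 2)) + of_nat (n - 3) * kap 1 (D (f 1)) else 0)"
proof -
  have "f n = br (f (n - 1)) (f 2)" using br_f[of "n - 1" 2] n_ge n_even by simp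
  then have "D (f n) = br (f (n - 1)) (D (f 2)) - br (f 2) (D (f (n - 1)))"
    using D_br[of "f (n - 1)" "f 2"] br_skew[of "D (f (n - 1))" "f 2"] by simp
  then have D: "kap m (D (f n)) = kap m (br (f (n - 1)) (D (f 2))) - kap m (br (f 2) (D (f (n - 1))))"
    by (simp add: kap_diff)
  have below: "kap 1 (D (f (n - 1))) = 0" using der_below[of "n - 1" 1] n_ge by simp
  have diag: "kap (n - 1) (D (f (n - 1))) = kap 2 (D (f 2)) + of_nat (n - 3) * kap 1 (D (f 1))"
    using der_diag[of "n - 1"] n_ge by simp
  have fst: "kap m (br (f (n - 1)) (D (f 2))) = (if m = n then kap 2 (D (f 2)) else 0)"
    using assms n_ge n_even kap_br_f[of "n - 1" m "D (f 2)"] by (simp add: kap1_der_f2)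
  have snd: "kap m (br (f 2) (D (f (n - 1)))) = (if m = n then - kap (n - 1) (D (f (n - 1))) else 0)"
    using assms n_ge kap_br_f[of 2 m "D (f (n - 1))"] below by simp
  show ?thesis using D fst snd diag by simp
qed

end

subsection \<open>The four-parameter family\<close>

lemma bilinear_eqI:
  assumes "bilinear_op scale g" "bilinear_op scale h"
    and eq: "\<And>i j. i \<in> {1..n} \<Longrightarrow> j \<in> {1..n} \<Longrightarrow> g (e i) (e j) = h (e i) (e j)"
  shows "g x y = h x y"
proof -
  have lin: "Vector_Spaces.linear scale scale (\<lambda>x. k x y)" "Vector_Spaces.linear scale scale (k x)"
    if "bilinear_op scale k" for k x y
    using that by (auto simp: bilinear_op_def)
  have "g (e i) y = h (e i) y" if "i \<in> {1..n}" for i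
    using linear_expand_e[OF lin(2)[OF assms(1)], of "e i" y]
      linear_expand_e[OF lin(2)[OF assms(2)], of "e i" y] eq that by simp
  then show ?thesis
    using linear_expand_e[OF lin(1)[OF assms(1), of y], of x]
      linear_expand_e[OF lin(1)[OF assms(2), of y], of x] by simp
qed

text \<open>The closed form sees its arguments only through their first two coordinates, so both CPA
  identities can be checked without expanding in basis vectors.\<close>

definition Q_mult :: "complex \<Rightarrow> complex \<Rightarrow> complex \<Rightarrow> complex \<Rightarrow> 'v \<Rightarrow> 'v \<Rightarrow> 'v" where
  "Q_mult \<alpha> \<beta> \<gamma> \<delta> x y =
     scale (\<alpha> * ((coef 1 x - coef 2 x) * (coef 1 y - coef 2 y))) (e (n - 1)) +
     scale (\<beta> * (coef 1 x * coef 1 y) + \<gamma> * (coef 1 x * coef 2 y + coef 2 x * coef 1 y)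
       + \<delta> * (coef 2 x * coef 2 y)) (e n)"

lemma Q_mult_commute: "Q_mult \<alpha> \<beta> \<gamma> \<delta> x y = Q_mult \<alpha> \<beta> \<gamma> \<delta> y x"
  by (simp add: Q_mult_def algebra_simps)

lemma linear_two_forms:
  assumes "\<And>x y. p (x + y) = p x + p y" "\<And>c x. p (scale c x) = c * p x"
    and "\<And>x y. q (x + y) = q x + q y" "\<And>c x. q (scale c x) = c * q x"
  shows "Vector_Spaces.linear scale scale (\<lambda>x. scale (p x) a + scale (q x) b)"
  unfolding Vector_Spaces.linear_iff
  by (simp add: assms vector_space_axioms scale_left_distrib scale_right_distrib add_ac)

lemma Q_mult_bilinear: "bilinear_op scale (Q_mult \<alpha> \<beta> \<gamma> \<delta>)"
proof -
  have left: "Vector_Spaces.linear scale scale (\<lambda>x. Q_mult \<alpha> \<beta> \<gamma> \<delta> x y)" for y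
    unfolding Q_mult_def
    by (rule linear_two_forms) (simp_all add: coef_add coef_scale algebra_simps)
  have "Vector_Spaces.linear scale scale (\<lambda>y. Q_mult \<alpha> \<beta> \<gamma> \<delta> x y)" for x
    by (subst Q_mult_commute) (rule left)
  with left show ?thesis unfolding bilinear_op_def by blast
qed

lemma Q_product_Q_mult: "Q_product scale n e \<alpha> \<beta> \<gamma> \<delta> (Q_mult \<alpha> \<beta> \<gamma> \<delta>)"
proof -
  have "Q_mult \<alpha> \<beta> \<gamma> \<delta> (e i) (e j) = 0"
    if "1 \<le> i" "i \<le> j" "j \<le> n" "(i, j) \<notin> {(1, 1), (1, 2), (2, 2)}" for i j
  proof -
    have "j \<noteq> 1" "j \<noteq> 2" using that by auto
    then show ?thesis using that n_ge by (simp add: Q_mult_def coef_e)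
  qed
  then show ?thesis
    unfolding Q_product_def
    by (intro conjI allI impI Q_mult_bilinear Q_mult_commute) (use n_ge in \<open>simp_all add: Q_mult_def coef_e\<close>)
qed

lemma Q_product_unique:
  assumes "Q_product scale n e \<alpha> \<beta> \<gamma> \<delta> g" "Q_product scale n e \<alpha> \<beta> \<gamma> \<delta> h"
  shows "g = h"
proof -
  note g = assms(1)[unfolded Q_product_def] and h = assms(2)[unfolded Q_product_def]
  have le: "g (e i) (e j) = h (e i) (e j)" if "1 \<le> i" "i \<le> j" "j \<le> n" for i j
  proof (cases "(i, j) \<in> {(1, 1), (1, 2), (2, 2)}")
    case True
    have "g (e 1) (e 1) = h (e 1) (e 1)" "g (e 1) (e 2) = h (e 1) (e 2)" "g (e 2) (e 2) = h (e 2) (e 2)"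
      by (simp_all only: g h)
    with True show ?thesis by auto
  next
    case False
    have "g (e i) (e j) = 0" "h (e i) (e j) = 0"
      using g h that False by blast+
    then show ?thesis by simp
  qed
  have comm: "g x y = g y x" "h x y = h y x" for x y
    using g h by blast+
  have eq: "g (e i) (e j) = h (e i) (e j)" if "i \<in> {1..n}" "j \<in> {1..n}" for i j
  proof (cases "i \<le> j")
    case True
    then show ?thesis using le that by simp
  next
    case False
    then have "g (e j) (e i) = h (e j) (e i)" using le that by simp
    then show ?thesis by (simp only: comm[of "e i" "e j"])
  qed
  have "bilinear_op scale g" "bilinear_op scale h" using g h by blast+
  then show ?thesis by (intro ext) (rule bilinear_eqI[of g h, OF _ _ eq])
qed

text \<open>Consequently \<open>Q_mult\<close> vanishes as soon as one argument is a
  bracket.\<close>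

lemma coef_br: "coef 1 (br x y) = 0" "coef 2 (br x y) = 0"
proof -
  have "kap m (br (f i) y) = 0" if "i \<in> {1..n}" "m = 1 \<or> m = 2" for i m
    using that n_ge kap_br_f1[of m y] kap_br_f[of i m y] by (cases "i = 1") auto
  then have "kap m (br x y) = 0" if "m = 1 \<or> m = 2" for m
    using kap_linear_expand[OF br_left, of m x y] that by simp
  from this[of 1] this[of 2] show "coef 1 (br x y) = 0" "coef 2 (br x y) = 0"
    by (simp_all add: kap_def)
qed

text \<open>\<open>e n\<close> is central, so only the \<open>e (n - 1)\<close> part contributes.
  What matters is the symmetry of the result in \<open>x\<close>, \<open>y\<close>,
  \<open>z\<close>.\<close>

lemma br_Q_mult:
  "br (Q_mult \<alpha> \<beta> \<gamma> \<delta> x y) z =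
     scale (- (\<alpha> * ((coef 1 x - coef 2 x) * (coef 1 y - coef 2 y) * (coef 1 z - coef 2 z)))) (e n)"
proof -
  interpret l: Vector_Spaces.linear scale scale "\<lambda>x. br x z" by (rule br_left)
  have "br (f n) z = 0"
    by (rule kap_eqI) (use n_ge in \<open>simp add: kap_br_f kap_zero\<close>)
  moreover have "br (f (n - 1)) z = scale (- (coef 1 z - coef 2 z)) (f n)"
  proof (rule kap_eqI)
    fix m assume "1 \<le> m" "m \<le> n"
    then show "kap m (br (f (n - 1)) z) = kap m (scale (- (coef 1 z - coef 2 z)) (f n))"
      using kap_br_f[of "n - 1" m z] n_ge n_even by (simp add: kap_scale kap_f kap_minus, simp add: kap_def)
  qed
  ultimately have br: "br (e n) z = 0" "br (e (n - 1)) z = scale (- (coef 1 z - coef 2 z)) (e n)"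
    using n_ge by (simp_all add: f_simps)
  show ?thesis
    unfolding Q_mult_def l.add l.scale br scale_zero_right add_0_right scale_scale
    by (rule arg_cong[where f = "\<lambda>c. scale c (e n)"]) (simp add: algebra_simps)
qed

lemma cpa_Q_mult: "cpa_structure scale br (Q_mult \<alpha> \<beta> \<gamma> \<delta>)"
proof
  let ?P = "Q_mult \<alpha> \<beta> \<gamma> \<delta>"
  show "bilinear_op scale ?P" by (rule Q_mult_bilinear)
  show "?P x y = ?P y x" for x y by (rule Q_mult_commute)
  have coef0: "coef 1 (?P x y) = 0" "coef 2 (?P x y) = 0" for x y
    using n_ge by (simp_all add: Q_mult_def coef_add coef_scale coef_e)
  have zero: "?P x y = 0" if "coef 1 y = 0" "coef 2 y = 0" for x y
    using that by (simp add: Q_mult_def)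
  \<comment> \<open>Every term vanishes: products and brackets alike have zero first and second
    coordinates.\<close>
  show "?P (br x y) z = ?P x (?P y z) - ?P y (?P x z)" for x y z
    using zero[of "br x y" z] by (simp add: zero coef0 coef_br Q_mult_commute[of _ _ _ _ "br x y"])
  show "?P x (br y z) = br (?P x y) z + br y (?P x z)" for x y z
  proof -
    \<comment> \<open>Skew-symmetry turns the sum into a difference of two values of one symmetric
      trilinear form.\<close>
    have "br (?P x y) z + br y (?P x z) = br (?P x y) z - br (?P x z) y"
      using br_skew[of y "?P x z"] by simp
    also have "\<dots> = 0" by (simp add: br_Q_mult algebra_simps)
    finally show ?thesis by (simp add: zero coef_br)
  qed
qed

end

subsection \<open>Classification\<close>

locale cpa_Q_even = lie_algebra_Q_even scale br n e + cpa_structure scale br prd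
  for scale :: "complex \<Rightarrow> 'v::ab_group_add \<Rightarrow> 'v"
    and br :: "'v \<Rightarrow> 'v \<Rightarrow> 'v" and n :: nat and e :: "nat \<Rightarrow> 'v"
    and prd :: "'v \<Rightarrow> 'v \<Rightarrow> 'v"
begin

section \<open>Structure constants as matrices of derivations\<close>

definition P :: "nat \<Rightarrow> nat \<Rightarrow> nat \<Rightarrow> complex" where
  "P i j m = kap m (prd (f i) (f j))"

lemma prd_left: "Vector_Spaces.linear scale scale (\<lambda>x. prd x y)"
  and prd_right: "Vector_Spaces.linear scale scale (prd x)"
  using prd_bilinear by (auto simp: bilinear_op_def)

lemma P_commute: "P i j m = P j i m"
  by (simp add: P_def prd_commute)

lemma P_2_1: "P a 2 1 = 0" and P_1_2: "P a 1 2 = 0"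
  unfolding P_def
  using kap1_der_f2[OF prd_right prd_bracket_right] kap2_der_f1[OF prd_right prd_bracket_right]
  by auto

lemma P_below:
  assumes "2 \<le> k" "k \<le> n" "1 \<le> m" "m < k"
  shows "P a k m = 0"
  using der_below[OF prd_right prd_bracket_right, of k m "f a"]
    der_fn[OF prd_right prd_bracket_right, of m "f a"] assms
  by (cases "k = n") (auto simp: P_def)

lemma P_diag:
  assumes "2 \<le> k" "k \<le> n - 1"
  shows "P a k k = P a 2 2 + of_nat (k - 2) * P a 1 1"
  using der_diag[OF prd_right prd_bracket_right assms] by (simp add: P_def)

lemma P_above:
  assumes "2 \<le> k" "k < m" "m \<le> n - 1"
  shows "P a k m = P a 2 (m + 2 - k)"
  using der_above[OF prd_right prd_bracket_right assms] by (simp only: P_def)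

lemma P_n:
  assumes "3 \<le> k" "k \<le> n - 1"
  shows "P a k n = - ((-1) ^ k) * P a 1 (n + 2 - k)"
  using der_n[OF prd_right prd_bracket_right assms] by (simp only: P_def)

lemma P_n_n: "P a n n = 2 * P a 2 2 + of_nat (n - 3) * P a 1 1"
  using der_fn[OF prd_right prd_bracket_right, of n] n_ge by (simp add: P_def)

lemma P_even_zero:
  assumes "even j" "4 \<le> j" "j \<le> n - 2"
  shows "P a 2 j = 0"
  using der_even_zero[OF prd_right prd_bracket_right assms] by (simp only: P_def)

text \<open>Left multiplication by \<open>f (Suc b) = [f 1, f b]\<close> is the commutator of those
  by \<open>f 1\<close> and \<open>f b\<close>. All later vanishing results obtained from the
  quadratic identity use this matrix form.\<close>

lemma P_Suc:
  assumes "2 \<le> b" "b \<le> n - 2"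
  shows "P (Suc b) c m = (\<Sum>k=1..n. P b c k * P 1 k m) - (\<Sum>k=1..n. P 1 c k * P b k m)"
proof -
  have "f (Suc b) = br (f 1) (f b)" using br_f1[of b] assms by simp
  then show ?thesis
    using kap_linear_expand[OF prd_right, of m "f 1" "prd (f b) (f c)"]
      kap_linear_expand[OF prd_right, of m "f b" "prd (f 1) (f c)"]
    by (simp add: P_def prd_bracket_left kap_diff)
qed

section \<open>The product of \<open>f 1\<close> and \<open>f 2\<close>\<close>

lemma P_1_2_zero_odd:
  assumes "odd i" "3 \<le> i" "i \<le> n - 3"
  shows "P 1 2 i = 0"
proof -
  define k where "k = n + 1 - i"
  have k: "even k" "4 \<le> k" "k \<le> n - 2" "n + 2 - k = i + 1" "n - 1 + 2 - k = i" "n + 2 - 3 = n - 1"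
      "i + 1 + 2 - 3 = i"
    using assms n_ge n_even unfolding k_def by auto
  \<comment> \<open>The sign is minus because \<open>k\<close> is even. With the roles of 3 and
    \<open>k\<close> exchanged it is plus, since 3 is odd, while both sides reduce to the same
    coordinate.\<close>
  have "P 3 k n = - P 3 1 (i + 1)" using P_n[of k 3] k by simp
  also have "\<dots> = - P 1 2 i"
    using P_above[of 3 "i + 1" 1] k assms by (simp add: P_commute[of 3 1])
  finally have "P 3 k n = - P 1 2 i" .
  moreover have "P k 3 n = P k 1 (n - 1)" using P_n[of 3 k] k n_ge by simp
  moreover have "P k 1 (n - 1) = P 1 2 i"
    using P_above[of k "n - 1" 1] k assms n_ge by (simp only: P_commute[of k 1])
  ultimately show ?thesis by (simp add: P_commute[of k 3])
qed

lemma P_1_2_zero: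
  assumes "3 \<le> i" "i \<le> n - 2"
  shows "P 1 2 i = 0"
proof (cases "even i")
  case True
  then have "i \<noteq> 3" by auto
  then show ?thesis using P_even_zero[of i 1] True assms by simp
next
  case False
  then have "i \<noteq> n - 2" using n_even n_ge by auto
  then show ?thesis using P_1_2_zero_odd[of i] False assms by simp
qed

lemma P_1_2_small: "P 1 2 1 = 0" "P 1 2 2 = 0" "P 1 2 3 = 0"
  using P_2_1[of 1] P_1_2[of 2] P_1_2_zero[of 3] n_ge by (simp_all add: P_commute[of 2 1])

section \<open>Vanishing of the diagonal\<close>

text \<open>Modulo commutators, \<open>f 1\<close> and \<open>f 2\<close> multiply like two orthogonal eigenvectors. The
  eigenvalues \<open>P 1 1 1\<close> and \<open>P 2 2 2\<close> are multiples of each other, and their product vanishes.\<close>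

lemma P_diag_zero: "P 1 1 1 = 0" "P 2 2 2 = 0"
proof -
  have n4: "4 \<le> n" "2 \<le> n - 2" "3 \<le> n - 2" "3 \<le> n" using n_ge by auto
  have d1: "P 1 3 3 = P 1 1 1" using P_diag[of 3 1] P_1_2_small n_ge by simp
  have d2: "P 2 3 3 = P 2 2 2"
    using P_diag[of 3 2] P_1_2_small n_ge by (simp add: P_commute[of 2 1])
  have low: "P a k 3 = 0" if "4 \<le> k" "k \<le> n" for a k
    using P_below[of k 3 a] that by simp
  have "(\<Sum>k=1..n. P 2 1 k * P 1 k 3) = P 2 1 3 * P 1 3 3"
    by (rule sum_single, simp, use n4 in simp)
      (metis small_nat_cases not_one_le_zero atLeastAtMost_iff low P_commute P_1_2_small(1,2) mult_zero_left mult_zero_right)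
  moreover have "(\<Sum>k=1..n. P 1 1 k * P 2 k 3) = P 1 1 3 * P 2 3 3"
    by (rule sum_single, simp, use n4 in simp)
      (metis small_nat_cases not_one_le_zero atLeastAtMost_iff low P_commute P_1_2_small(3) P_1_2 mult_zero_left mult_zero_right)
  \<comment> \<open>This is the third coordinate of \<open>f 3 \<cdot> f 1\<close> with
    \<open>f 3 = [f 1, f 2]\<close>; by commutativity and \<open>d1\<close> the left side is the
    eigenvalue \<open>P 1 1 1\<close>.\<close>
  ultimately have A: "P 1 1 1 = - (P 1 1 3 * P 2 2 2)"
    using P_Suc[of 2 1 3] d1 d2 n4 P_1_2_small(3) P_commute[of 2 1 3] P_commute[of 3 1 3]
    by simp
  have "(\<Sum>k=1..n. P 2 2 k * P 1 k 3) = P 2 2 3 * P 1 3 3"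
    by (rule sum_single, simp, use n4 in simp)
      (metis small_nat_cases not_one_le_zero atLeastAtMost_iff low P_2_1 P_1_2_small(3) mult_zero_left mult_zero_right)
  moreover have "(\<Sum>k=1..n. P 1 2 k * P 2 k 3) = 0"
    by (rule sum.neutral, rule ballI)
      (metis small_nat_cases not_one_le_zero atLeastAtMost_iff low P_1_2_small mult_zero_left mult_zero_right)
  ultimately have B: "P 2 2 2 = P 2 2 3 * P 1 1 1"
    using P_Suc[of 2 2 3] d1 d2 n4 P_commute[of 3 2 3] by simp
  have P32: "P 3 2 2 = 0" using P_below[of 3 2 2] n4 by (simp add: P_commute[of 3 2])
  have "(\<Sum>k=1..n. P 3 2 k * P 1 k 3) = P 3 2 3 * P 1 3 3"
    by (rule sum_single, simp, use n4 in simp)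
      (metis small_nat_cases not_one_le_zero atLeastAtMost_iff low P_2_1 P32 mult_zero_left mult_zero_right)
  moreover have "(\<Sum>k=1..n. P 1 2 k * P 3 k 3) = 0"
    by (rule sum.neutral, rule ballI)
      (metis small_nat_cases not_one_le_zero atLeastAtMost_iff low P_1_2_small mult_zero_left mult_zero_right)
  \<comment> \<open>The third coordinate of \<open>f 4 \<cdot> f 2\<close> with
    \<open>f 4 = [f 1, f 3]\<close> is zero, as left multiplication by \<open>f 2\<close> is
    triangular. Whichever eigenvalue vanishes, \<open>A\<close> or \<open>B\<close> then forces the
    other to vanish.\<close>
  ultimately have "P 2 2 2 * P 1 1 1 = 0"
    using P_Suc[of 3 2 3] d1 d2 n4 low[of 4 2] P_commute[of 4 2 3] P_commute[of 3 2 3] by simp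
  with A B show "P 1 1 1 = 0" "P 2 2 2 = 0" by auto
qed

lemma P_diag_zero':
  assumes "a \<in> {1..n}"
  shows "P a 1 1 = 0" "P a 2 2 = 0"
proof -
  consider "a = 1" | "a = 2" | "3 \<le> a" using assms by force
  then have "P a 1 1 = 0 \<and> P a 2 2 = 0"
  proof cases
    case 1
    then show ?thesis using P_diag_zero P_1_2_small by simp
  next
    case 2
    then show ?thesis using P_diag_zero P_1_2_small by (simp add: P_commute[of 2 1])
  next
    case 3
    then show ?thesis
      using P_below[of a 1 1] P_below[of a 2 2] assms by (simp add: P_commute[of a 1] P_commute[of a 2])
  qed
  then show "P a 1 1 = 0" "P a 2 2 = 0" by auto
qed

section \<open>Products with \<open>f k\<close>, \<open>k \<ge> 3\<close>, are multiples of
  \<open>f n\<close>\<close>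

lemma P_at_or_below:
  assumes "a \<in> {1..n}" "2 \<le> k" "k \<le> n" "1 \<le> m" "m \<le> k"
  shows "P a k m = 0"
proof -
  have "P a k k = 0"
    using P_diag[of k a] P_n_n[of a] P_diag_zero'[OF assms(1)] assms by (cases "k = n") auto
  then show ?thesis using P_below[of k m a] assms by (cases "m = k") auto
qed

text \<open>Above the diagonal, the Toeplitz form reduces to coordinate \<open>m + 2 - k\<close> of
  \<open>f 1 \<cdot> f 2\<close>. This index lies between 3 and \<open>n - 2\<close>, where the
  coordinate is known to vanish.\<close>

lemma P_1_zero:
  assumes "3 \<le> k" "k \<le> n" "1 \<le> m" "m \<le> n - 1"
  shows "P 1 k m = 0"
proof (cases "m \<le> k")
  case True
  then show ?thesis using P_at_or_below[of 1 k m] assms by simp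
next
  case False
  moreover have "P 1 2 (m + 2 - k) = 0"
    using P_1_2_zero[of "m + 2 - k"] False assms by auto
  ultimately show ?thesis using P_above[of k m 1] assms by auto
qed

text \<open>By the Toeplitz form, \<open>P 2 2 m\<close> is coordinate \<open>m + 1\<close> of
  \<open>f 3 \<cdot> f 2\<close>. It is read off from \<open>f 3 = [f 1, f 2]\<close>, where every
  summand has a factor already known to be zero.\<close>

lemma P_2_2_zero:
  assumes "3 \<le> m" "m \<le> n - 2"
  shows "P 2 2 m = 0"
proof -
  have "(\<Sum>k=1..n. P 2 2 k * P 1 k (m + 1)) = 0"
  proof (rule sum.neutral, rule ballI)
    fix k assume "k \<in> {1..n}"
    moreover have "P 1 k (m + 1) = 0" if "3 \<le> k"
      using P_1_zero[of k "m + 1"] that assms calculation by auto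
    ultimately show "P 2 2 k * P 1 k (m + 1) = 0"
      using P_2_1[of 2] P_diag_zero by (cases k rule: small_nat_cases) auto
  qed
  moreover have "(\<Sum>k=1..n. P 1 2 k * P 2 k (m + 1)) = 0"
  proof (rule sum.neutral, rule ballI)
    fix k assume k: "k \<in> {1..n}"
    have "P 1 2 k = 0" if "k \<le> n - 2"
      using k that P_1_2_small P_1_2_zero[of k] by (cases k rule: small_nat_cases) auto
    moreover have "P 2 k (m + 1) = 0" if "\<not> k \<le> n - 2"
      using P_at_or_below[of 2 k "m + 1"] k that assms n_ge by auto
    ultimately show "P 1 2 k * P 2 k (m + 1) = 0" by auto
  qed
  moreover have "P 2 3 (m + 1) = P 2 2 m" using P_above[of 3 "m + 1" 2] assms by simp
  ultimately show ?thesis using P_Suc[of 2 2 "m + 1"] P_commute[of 3 2 "m + 1"] assms by simp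
qed

lemma P_2_zero:
  assumes "3 \<le> k" "k \<le> n" "1 \<le> m" "m \<le> n - 1"
  shows "P 2 k m = 0"
proof (cases "m \<le> k")
  case True
  then show ?thesis using P_at_or_below[of 2 k m] assms by simp
next
  case False
  moreover have "P 2 2 (m + 2 - k) = 0"
    using P_2_2_zero[of "m + 2 - k"] False assms by auto
  ultimately show ?thesis using P_above[of k m 2] assms by auto
qed

lemma P_zero:
  assumes "j \<in> {1..n}" "3 \<le> k" "k \<le> n" "1 \<le> m" "m \<le> n - 1"
  shows "P j k m = 0"
proof -
  consider "j = 1" | "j = 2" | "3 \<le> j" "m \<le> k" | "3 \<le> j" "k < m" using assms by force
  then show ?thesis
  proof cases
    case 4
    have "P 2 j (m + 2 - k) = 0" using P_2_zero[of j "m + 2 - k"] 4 assms by auto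
    then show ?thesis using P_above[of k m j] 4 assms by (simp add: P_commute[of j 2])
  qed (use P_1_zero P_2_zero P_at_or_below[of j k m] assms in auto)
qed

section \<open>The last coordinates\<close>

lemma P_last_n: "a \<in> {1..n} \<Longrightarrow> P a n n = 0"
  using P_at_or_below[of a n n] n_ge by simp

lemma P_n_zero:
  assumes "3 \<le> j" "j \<le> n" "3 \<le> k" "k \<le> n"
  shows "P j k n = 0"
proof (cases "k = n")
  case True
  then show ?thesis using P_last_n[of j] assms by simp
next
  case False
  have "P 1 j (n + 2 - k) = 0" using P_1_zero[of j "n + 2 - k"] False assms by auto
  then show ?thesis using P_n[of k j] False assms by (simp add: P_commute[of j 1])
qed

text \<open>The bound 4 is forced at this stage: \<open>k = 3\<close> would lead to coordinate
  \<open>n - 1\<close> of \<open>f 1 \<cdot> f 2\<close>, which is treated only later.\<close>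

lemma P_2_n_zero:
  assumes "4 \<le> k" "k \<le> n"
  shows "P 2 k n = 0"
proof (cases "k = n")
  case True
  then show ?thesis using P_last_n[of 2] n_ge by simp
next
  case False
  have "P 1 2 (n + 2 - k) = 0" using P_1_2_zero[of "n + 2 - k"] False assms by auto
  then show ?thesis using P_n[of k 2] False assms by (simp add: P_commute[of 2 1])
qed

text \<open>Up to sign, \<open>P 1 1 i\<close> is the last coordinate of
  \<open>f 1 \<cdot> f (Suc k)\<close> for \<open>k = n + 1 - i\<close>; the quadratic identity for
  \<open>[f 1, f k] \<cdot> f 1\<close> makes that coordinate zero.\<close>

lemma P_1_1_zero:
  assumes "3 \<le> i" "i \<le> n - 2"
  shows "P 1 1 i = 0"
proof -
  define k where "k = n + 1 - i"
  have k: "3 \<le> k" "k \<le> n - 2" "n + 2 - Suc k = i" using assms unfolding k_def by auto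
  have "(\<Sum>j=1..n. P k 1 j * P 1 j n) = 0"
  proof (rule sum.neutral, rule ballI)
    fix j assume "j \<in> {1..n}"
    then show "P k 1 j * P 1 j n = 0"
      using P_1_zero[of k j] P_last_n[of 1] k n_ge
      by (cases "j = n") (auto simp: P_commute[of k 1])
  qed
  moreover have "(\<Sum>j=1..n. P 1 1 j * P k j n) = 0"
  proof (rule sum.neutral, rule ballI)
    fix j assume "j \<in> {1..n}"
    then show "P 1 1 j * P k j n = 0"
      using P_diag_zero P_1_2[of 1] P_n_zero[of k j] k by (cases j rule: small_nat_cases) auto
  qed
  ultimately have "P 1 (Suc k) n = 0" using P_Suc[of k 1 n] k by (simp add: P_commute[of "Suc k" 1])
  then show ?thesis using P_n[of "Suc k" 1] k by simp
qed

lemma P_1_n_zero: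
  assumes "4 \<le> k" "k \<le> n"
  shows "P 1 k n = 0"
proof (cases "k = n")
  case True
  then show ?thesis using P_last_n[of 1] n_ge by simp
next
  case False
  have "P 1 1 (n + 2 - k) = 0" using P_1_1_zero[of "n + 2 - k"] False assms by auto
  then show ?thesis using P_n[of k 1] False assms by simp
qed

lemma P_1_2_small':
  assumes "1 \<le> k" "k \<le> n - 2"
  shows "P 1 2 k = 0"
  using assms P_1_2_small P_1_2_zero[of k] by (cases k rule: small_nat_cases) auto

lemma P_1_1_small:
  assumes "1 \<le> k" "k \<le> n - 2"
  shows "P 1 1 k = 0"
  using assms P_diag_zero P_1_2[of 1] P_1_1_zero[of k] by (cases k rule: small_nat_cases) auto

lemma P_2_2_small:
  assumes "1 \<le> k" "k \<le> n - 2"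
  shows "P 2 2 k = 0"
  using assms P_diag_zero P_2_1[of 2] P_2_2_zero[of k] by (cases k rule: small_nat_cases) auto

lemma P_3_n: "P a 3 n = P a 1 (n - 1)"
proof -
  have "n + 2 - 3 = n - 1" by simp
  then show ?thesis using P_n[of 3 a] n_ge by simp
qed

text \<open>By \<open>P_3_n\<close> this is the last coordinate of
  \<open>[f 1, f 2] \<cdot> f 1\<close>. In each summand the first factor vanishes for
  \<open>j \<le> n - 2\<close> and the second for larger \<open>j\<close>.\<close>

lemma P_1_1_pred_n: "P 1 1 (n - 1) = 0"
proof -
  have zero: "P 2 1 j * P 1 j n = 0" "P 1 1 j * P 2 j n = 0" if "j \<in> {1..n}" for j
    using that n_ge P_1_2_small'[of j] P_1_1_small[of j] P_1_n_zero[of j] P_2_n_zero[of j]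
    by (cases "j \<le> n - 2"; auto simp: P_commute[of 2 1])+
  have "(\<Sum>j=1..n. P 2 1 j * P 1 j n) = 0" "(\<Sum>j=1..n. P 1 1 j * P 2 j n) = 0"
    by (intro sum.neutral ballI zero; assumption)+
  then have "P 3 1 n = 0" using P_Suc[of 2 1 n] n_ge by simp
  then show ?thesis by (simp add: P_3_n P_commute[of 3 1])
qed

lemma P_1_2_pred_n: "P 1 2 (n - 1) = 0"
proof -
  have zero: "P 2 2 j * P 1 j n = 0" "P 1 2 j * P 2 j n = 0" if "j \<in> {1..n}" for j
    using that n_ge P_1_2_small'[of j] P_2_2_small[of j] P_1_n_zero[of j] P_2_n_zero[of j]
    by (cases "j \<le> n - 2"; auto)+
  have "(\<Sum>j=1..n. P 2 2 j * P 1 j n) = 0" "(\<Sum>j=1..n. P 1 2 j * P 2 j n) = 0"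
    by (intro sum.neutral ballI zero; assumption)+
  then have "P 3 2 n = 0" using P_Suc[of 2 2 n] n_ge by simp
  then show ?thesis by (simp add: P_3_n P_commute[of 3 2] P_commute[of 2 1])
qed

section \<open>The resulting multiplication table\<close>

lemma prd_f_zero:
  assumes "j \<in> {1..n}" "3 \<le> k" "k \<le> n"
  shows "prd (f j) (f k) = 0"
proof (rule kap_eqI)
  fix m assume m: "1 \<le> m" "m \<le> n"
  consider "j = 1" "k = 3" | "j = 1" "4 \<le> k" | "j = 2" "k = 3" | "j = 2" "4 \<le> k" | "3 \<le> j"
    using assms by force
  then have "P j k n = 0"
    using assms P_1_n_zero[of k] P_2_n_zero[of k] P_n_zero[of j k] P_1_1_pred_n P_1_2_pred_n
    by cases (auto simp: P_3_n P_commute[of 2 1])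
  then have "P j k m = 0" using P_zero[of j k m] assms m by (cases "m = n") auto
  then show "kap m (prd (f j) (f k)) = kap m 0" by (simp add: P_def kap_zero)
qed

lemma prd_f_small:
  "prd (f 1) (f 1) = scale (P 1 1 n) (e n)"
  "prd (f 1) (f 2) = scale (P 1 2 n) (e n)"
  "prd (f 2) (f 2) = scale (P 2 2 (n - 1)) (e (n - 1)) + scale (P 2 2 n) (e n)"
proof -
  have e: "e n = f n" "e (n - 1) = f (n - 1)" using n_ge by (simp_all add: f_simps)
  have cases: "m \<le> n - 2 \<or> m = n - 1 \<or> m = n" if "m \<le> n" for m using that by auto
  show "prd (f 1) (f 1) = scale (P 1 1 n) (e n)"
  proof (rule kap_eqI)
    fix m assume m: "1 \<le> m" "m \<le> n"
    have "P 1 1 m = 0" if "m \<noteq> n"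
      using P_1_1_small[of m] P_1_1_pred_n cases m that by auto
    then show "kap m (prd (f 1) (f 1)) = kap m (scale (P 1 1 n) (e n))"
      using m by (auto simp: e kap_scale kap_f P_def)
  qed
  show "prd (f 1) (f 2) = scale (P 1 2 n) (e n)"
  proof (rule kap_eqI)
    fix m assume m: "1 \<le> m" "m \<le> n"
    have "P 1 2 m = 0" if "m \<noteq> n"
      using P_1_2_small'[of m] P_1_2_pred_n cases m that by auto
    then show "kap m (prd (f 1) (f 2)) = kap m (scale (P 1 2 n) (e n))"
      using m by (auto simp: e kap_scale kap_f P_def)
  qed
  show "prd (f 2) (f 2) = scale (P 2 2 (n - 1)) (e (n - 1)) + scale (P 2 2 n) (e n)"
  proof (rule kap_eqI)
    fix m assume m: "1 \<le> m" "m \<le> n"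
    have "P 2 2 m = 0" if "m \<noteq> n" "m \<noteq> n - 1"
      using P_2_2_small[of m] cases m that by auto
    then show "kap m (prd (f 2) (f 2)) =
        kap m (scale (P 2 2 (n - 1)) (e (n - 1)) + scale (P 2 2 n) (e n))"
      using m n_ge by (auto simp: e kap_add kap_scale kap_f P_def)
  qed
qed

text \<open>The parameters come from substituting \<open>e 1 = f 1 - f 2\<close> and
  \<open>e 2 = f 2\<close>. Among products of \<open>f 1\<close> and \<open>f 2\<close> only
  \<open>f 2 \<cdot> f 2\<close> has an \<open>e (n - 1)\<close> part, which explains the
  alternating signs of \<open>\<alpha>\<close>.\<close>

lemma Q_product_prd:
  "Q_product scale n e (P 2 2 (n - 1)) (P 1 1 n - 2 * P 1 2 n + P 2 2 n)
     (P 1 2 n - P 2 2 n) (P 2 2 n) prd"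
proof -
  have add: "prd (x + y) z = prd x z + prd y z" "prd z (x + y) = prd z x + prd z y" for x y z
    using prd_left[of z] prd_right[of z] by (simp_all add: Vector_Spaces.linear_iff)
  have minus: "prd (x - y) z = prd x z - prd y z" "prd z (x - y) = prd z x - prd z y" for x y z
    using add(1)[of "x - y" y z] add(2)[of z "x - y" y] by simp_all
  have e: "e 1 = f 1 - f 2" "e 2 = f 2" "\<And>k. 3 \<le> k \<Longrightarrow> e k = f k"
    by (simp_all add: f_simps)
  have two: "scale (2 * c) v = scale c v + scale c v" for c v
    by (simp only: mult_2 scale_left_distrib)
  have "prd (e 1) (e 1) = prd (f 1) (f 1) - prd (f 1) (f 2) - prd (f 1) (f 2) + prd (f 2) (f 2)"
    unfolding e by (simp add: minus prd_commute[of "f 2" "f 1"] algebra_simps)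
  then have 11: "prd (e 1) (e 1) = scale (P 2 2 (n - 1)) (e (n - 1))
      + scale (P 1 1 n - 2 * P 1 2 n + P 2 2 n) (e n)"
    unfolding prd_f_small by (simp add: scale_left_distrib scale_left_diff_distrib two algebra_simps)
  have 12: "prd (e 1) (e 2) = - scale (P 2 2 (n - 1)) (e (n - 1)) + scale (P 1 2 n - P 2 2 n) (e n)"
    unfolding e(1,2) minus prd_f_small by (simp add: scale_left_diff_distrib algebra_simps)
  have "prd (e i) (e j) = 0"
    if ij: "1 \<le> i" "i \<le> j" "j \<le> n" "(i, j) \<notin> {(1, 1), (1, 2), (2, 2)}" for i j
  proof -
    have j: "3 \<le> j" "j \<le> n" using ij by auto
    consider "i = 1" | "i = 2" | "3 \<le> i" using ij by force
    then show ?thesis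
    proof cases
      case 1
      then show ?thesis using j n_ge by (simp add: e minus prd_f_zero)
    qed (use e j ij prd_f_zero[of i j] in auto)
  qed
  then show ?thesis
    unfolding Q_product_def using prd_bilinear prd_commute 11 12 prd_f_small(3) by (auto simp: e(2))
qed

end

theorem proposition3p12:
  fixes scale :: "complex \<Rightarrow> 'v::ab_group_add \<Rightarrow> 'v"
    and br :: "'v \<Rightarrow> 'v \<Rightarrow> 'v"
    and n :: nat
    and e :: "nat \<Rightarrow> 'v"
  assumes "n \<ge> 6" and "even n"
    and "lie_algebra_Q scale br n e"
  shows "(\<forall>prd. cpa_structure scale br prd \<longrightarrow>
            (\<exists>\<alpha> \<beta> \<gamma> \<delta>. Q_product scale n e \<alpha> \<beta> \<gamma> \<delta> prd)) \<and>
         (\<forall>\<alpha> \<beta> \<gamma> \<delta>. \<exists>!prd. Q_product scale n e \<alpha> \<beta> \<gamma> \<delta> prd) \<and>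
         (\<forall>\<alpha> \<beta> \<gamma> \<delta> prd. Q_product scale n e \<alpha> \<beta> \<gamma> \<delta> prd \<longrightarrow> cpa_structure scale br prd)"
proof -
  have Q: "lie_algebra_Q_even scale br n e"
    using assms by (simp add: lie_algebra_Q_even_def lie_algebra_Q_even_axioms_def)
  interpret lie_algebra_Q_even scale br n e by (rule Q)
  have "\<exists>\<alpha> \<beta> \<gamma> \<delta>. Q_product scale n e \<alpha> \<beta> \<gamma> \<delta> prd" if "cpa_structure scale br prd" for prd
  proof -
    interpret c: cpa_structure scale br prd by (rule that)
    interpret c: cpa_Q_even scale br n e prd ..
    show ?thesis using c.Q_product_prd by blast
  qed
  moreover have "\<exists>!prd. Q_product scale n e \<alpha> \<beta> \<gamma> \<delta> prd" for \<alpha> \<beta> \<gamma> \<delta>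
    using Q_product_Q_mult Q_product_unique by blast
  \<comment> \<open>The table determines the product, so it coincides with \<open>Q_mult\<close>,
    for which the identities have been checked.\<close>
  moreover have "cpa_structure scale br prd" if "Q_product scale n e \<alpha> \<beta> \<gamma> \<delta> prd" for \<alpha> \<beta> \<gamma> \<delta> prd
    using Q_product_unique[OF that Q_product_Q_mult] cpa_Q_mult by simp
  ultimately show ?thesis by blast
qed

end
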